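(* Let $n\geq 1$ and $0\leq k\leq m\leq n$ be integers. Let $T$ be a uniformly random subset of $[n]=\{1,2,\ldots,n\}$ of size $m$. Given $T$, let $S$ be a uniformly random subset of $T$ of size $k$. Then \[R(S,T)=\sqrt{\frac{k(n-m)}{m(n-k)}},\] with the convention that $0/0=0$.
   Context: For two random elements $X,Y$, the maximal correlation coefficient is $R(X,Y)=\sup \rho(\varphi(X),\psi(Y))$, where $\rho$ denotes the Pearson correlation coefficient and the supremum is over all real-valued measurable functions $\varphi,\psi$ such that $\varphi(X)$ and $\psi(Y)$ are square-integrable with positive variance. If $X$ or $Y$ is degenerate (almost surely constant), one sets $R(X,Y)=0$. Random subsets of $[n]$ are random elements of the finite set of all subsets of $[n]$. *)

theory Defs
  imports "HOL-Probability.Probability"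
begin

definition pearson_correlation :: "'a measure \<Rightarrow> ('a \<Rightarrow> real) \<Rightarrow> ('a \<Rightarrow> real) \<Rightarrow> real" where
  "pearson_correlation M U V =
     prob_space.expectation M
       (\<lambda>\<omega>. (U \<omega> - prob_space.expectation M U) * (V \<omega> - prob_space.expectation M V))
     / sqrt (prob_space.variance M U * prob_space.variance M V)"

definition square_integrable_nonconst :: "'a measure \<Rightarrow> ('a \<Rightarrow> real) \<Rightarrow> bool" where
  "square_integrable_nonconst M U \<longleftrightarrow>
     U \<in> borel_measurable M \<and> integrable M (\<lambda>\<omega>. (U \<omega>)\<^sup>2) \<and> prob_space.variance M U > 0"

definition degenerate :: "'a measure \<Rightarrow> 'b measure \<Rightarrow> ('a \<Rightarrow> 'b) \<Rightarrow> bool" where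
  "degenerate M MX X \<longleftrightarrow> (\<exists>c\<in>space MX. AE \<omega> in M. X \<omega> = c)"

(* Intended for random elements X of MX and Y of MY. For random elements of a finite set with
   all subsets measurable, the supremum is over a nonempty set bounded by 1 whenever neither
   X nor Y is degenerate, so Sup on the reals has its usual meaning. *)
definition maximal_correlation ::
  "'a measure \<Rightarrow> 'b measure \<Rightarrow> 'c measure \<Rightarrow> ('a \<Rightarrow> 'b) \<Rightarrow> ('a \<Rightarrow> 'c) \<Rightarrow> real" where
  "maximal_correlation M MX MY X Y =
     (if degenerate M MX X \<or> degenerate M MY Y then 0
      else Sup {pearson_correlation M (\<lambda>\<omega>. \<phi> (X \<omega>)) (\<lambda>\<omega>. \<psi> (Y \<omega>)) | \<phi> \<psi>.
             \<phi> \<in> borel_measurable MX \<and> \<psi> \<in> borel_measurable MY \<and>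
             square_integrable_nonconst M (\<lambda>\<omega>. \<phi> (X \<omega>)) \<and>
             square_integrable_nonconst M (\<lambda>\<omega>. \<psi> (Y \<omega>))})"

definition subset_space :: "nat \<Rightarrow> nat set measure" where
  "subset_space n = count_space (Pow {1..n})"

end

theory Submission
  imports Defs
begin

text \<open>The upper bound is a statement about the operators \<open>up_sum\<close> (from functions on \<open>j\<close>-subsets of an
  \<open>n\<close>-set to functions on \<open>(j + 1)\<close>-subsets) and \<open>down_sum\<close>, which are mutually adjoint and satisfy
  \<open>D U - U D = n - 2 j\<close> on \<open>j\<close>-subsets. By induction on \<open>j\<close> this gives
  \<open>\<parallel>U f\<parallel>\<^sup>2 \<le> j (n - j - 1) \<parallel>f\<parallel>\<^sup>2\<close> for centred \<open>f\<close>: indeed \<open>\<parallel>U f\<parallel>\<^sup>2 = \<parallel>D f\<parallel>\<^sup>2 + (n - 2 j) \<parallel>f\<parallel>\<^sup>2\<close>, and \<open>D\<close> is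
  the adjoint of \<open>U\<close> one level below. Up to a factor, the conditional expectation of \<open>f(S)\<close> given \<open>T\<close>
  is an iterate of \<open>U\<close>, and the product of the one-step bounds telescopes to the claimed value. It is
  attained by the indicators of \<open>1 \<in> S\<close> and \<open>1 \<in> T\<close>.\<close>

section \<open>Up and down operators between neighbouring levels of subsets\<close>

abbreviation subsets_of_card :: "'a set \<Rightarrow> nat \<Rightarrow> 'a set set" where
  "subsets_of_card V j \<equiv> {A. A \<subseteq> V \<and> card A = j}"

definition up_sum :: "('a set \<Rightarrow> real) \<Rightarrow> 'a set \<Rightarrow> real" where
  "up_sum f B = (\<Sum>x\<in>B. f (B - {x}))"

definition down_sum :: "'a set \<Rightarrow> ('a set \<Rightarrow> real) \<Rightarrow> 'a set \<Rightarrow> real" where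
  "down_sum V f A = (\<Sum>x\<in>V - A. f (insert x A))"

text \<open>On an \<open>m\<close>-set \<open>B\<close> this is \<open>m choose k\<close> times the
  conditional expectation of \<open>f (S)\<close> given \<open>T = B\<close>. It is also the
  \<open>(m - k)\<close>-fold iterate of \<open>up_sum\<close> divided by the factorial of
  \<open>m - k\<close>.\<close>

definition subset_sum :: "nat \<Rightarrow> ('a set \<Rightarrow> real) \<Rightarrow> 'a set \<Rightarrow> real" where
  "subset_sum k f B = (\<Sum>A\<in>subsets_of_card B k. f A)"

text \<open>Double counting: pairs of a set \<open>B\<close> and a point in it correspond to pairs
  of a set \<open>A\<close> and a point outside it, through \<open>A = B - {x}\<close>.\<close>

lemma sum_remove_eq_sum_insert:
  assumes "finite V"
  shows "(\<Sum>B\<in>subsets_of_card V (Suc j). \<Sum>x\<in>B. F B x) =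
    (\<Sum>A\<in>subsets_of_card V j. \<Sum>x\<in>V - A. F (insert x A) x)"
proof -
  have "(\<Sum>B\<in>subsets_of_card V (Suc j). \<Sum>x\<in>B. F B x) =
      (\<Sum>(B, x)\<in>(SIGMA B:subsets_of_card V (Suc j). B). F B x)"
    using assms by (intro sum.Sigma) (auto intro: finite_subset)
  also have "\<dots> = (\<Sum>(A, x)\<in>(SIGMA A:subsets_of_card V j. V - A). F (insert x A) x)"
    using assms
    by (intro sum.reindex_bij_witness[of _ "\<lambda>(A, x). (insert x A, x)" "\<lambda>(B, x). (B - {x}, x)"])
       (auto simp: card_Diff_singleton card_insert_if finite_subset insert_absorb)
  also have "\<dots> = (\<Sum>A\<in>subsets_of_card V j. \<Sum>x\<in>V - A. F (insert x A) x)"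
    using assms by (intro sum.Sigma[symmetric]) auto
  finally show ?thesis .
qed

lemma up_down_adjoint:
  assumes "finite V"
  shows "(\<Sum>B\<in>subsets_of_card V (Suc j). up_sum f B * g B) =
    (\<Sum>A\<in>subsets_of_card V j. f A * down_sum V g A)"
proof -
  have "(\<Sum>B\<in>subsets_of_card V (Suc j). up_sum f B * g B) =
      (\<Sum>B\<in>subsets_of_card V (Suc j). \<Sum>x\<in>B. f (B - {x}) * g B)"
    by (simp add: up_sum_def sum_distrib_right)
  also have "\<dots> = (\<Sum>A\<in>subsets_of_card V j. f A * down_sum V g A)"
    unfolding sum_remove_eq_sum_insert[OF assms]
    by (auto simp: down_sum_def sum_distrib_left intro!: sum.cong)
  finally show ?thesis .
qed

text \<open>Both compositions exchange a point of \<open>A\<close> for a point outside it, and these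
  exchanges agree in either order. They differ only in the moves that return to \<open>A\<close>:
  \<open>card V - j\<close> of them when inserting first, \<open>j\<close> when removing
  first.\<close>

lemma down_up_commutator:
  assumes "finite V" and A: "A \<subseteq> V" "card A = j"
  shows "down_sum V (up_sum f) A = up_sum (down_sum V f) A + (real (card V) - 2 * real j) * f A"
proof -
  have fA: "finite A" using assms finite_subset by blast
  have up: "up_sum f (insert x A) = f A + (\<Sum>y\<in>A. f (insert x (A - {y})))" if "x \<in> V - A" for x
  proof -
    have "insert x A - {y} = insert x (A - {y})" if "y \<in> A" for y
      using that \<open>x \<in> V - A\<close> by auto
    then show ?thesis
      using that fA by (simp add: up_sum_def)
  qed
  have down: "down_sum V f (A - {y}) = f A + (\<Sum>x\<in>V - A. f (insert x (A - {y})))" if "y \<in> A" for y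
  proof -
    have "V - (A - {y}) = insert y (V - A)" using that A by auto
    then show ?thesis
      using that assms(1) by (simp add: down_sum_def insert_absorb)
  qed
  have card: "real (card (V - A)) = real (card V) - real j"
    using A card_mono[OF assms(1) A(1)] fA by (simp add: card_Diff_subset of_nat_diff)
  have "down_sum V (up_sum f) A =
      (real (card V) - real j) * f A + (\<Sum>x\<in>V - A. \<Sum>y\<in>A. f (insert x (A - {y})))"
    by (simp add: down_sum_def up sum.distrib card)
  moreover have "up_sum (down_sum V f) A =
      real j * f A + (\<Sum>y\<in>A. \<Sum>x\<in>V - A. f (insert x (A - {y})))"
    using A by (simp add: up_sum_def down sum.distrib)
  moreover have "(\<Sum>x\<in>V - A. \<Sum>y\<in>A. f (insert x (A - {y}))) =
      (\<Sum>y\<in>A. \<Sum>x\<in>V - A. f (insert x (A - {y})))"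
    by (rule sum.swap)
  ultimately show ?thesis by (simp add: algebra_simps)
qed

lemma norm_up_sum:
  assumes "finite V"
  shows "(\<Sum>B\<in>subsets_of_card V (Suc (Suc j)). (up_sum f B)\<^sup>2) =
    (\<Sum>C\<in>subsets_of_card V j. (down_sum V f C)\<^sup>2) +
    (real (card V) - 2 * real (Suc j)) * (\<Sum>A\<in>subsets_of_card V (Suc j). (f A)\<^sup>2)"
proof -
  have "(\<Sum>B\<in>subsets_of_card V (Suc (Suc j)). (up_sum f B)\<^sup>2) =
      (\<Sum>A\<in>subsets_of_card V (Suc j). f A * down_sum V (up_sum f) A)"
    unfolding power2_eq_square by (rule up_down_adjoint[OF assms])
  also have "\<dots> = (\<Sum>A\<in>subsets_of_card V (Suc j). up_sum (down_sum V f) A * f A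
      + (real (card V) - 2 * real (Suc j)) * (f A)\<^sup>2)"
    using assms
    by (intro sum.cong refl) (auto simp: down_up_commutator power2_eq_square algebra_simps)
  also have "\<dots> = (\<Sum>C\<in>subsets_of_card V j. (down_sum V f C)\<^sup>2) +
    (real (card V) - 2 * real (Suc j)) * (\<Sum>A\<in>subsets_of_card V (Suc j). (f A)\<^sup>2)"
    by (simp only: sum.distrib up_down_adjoint[OF assms] sum_distrib_left power2_eq_square)
  finally show ?thesis .
qed

section \<open>One-step bound for centred functions\<close>

lemma norm_up_sum_le:
  assumes "finite V" "j \<le> card V" "(\<Sum>A\<in>subsets_of_card V j. f A) = 0"
  shows "(\<Sum>B\<in>subsets_of_card V (Suc j). (up_sum f B)\<^sup>2)
    \<le> real j * (real (card V) - real j - 1) * (\<Sum>A\<in>subsets_of_card V j. (f A)\<^sup>2)"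
  using assms(2,3)
proof (induction j arbitrary: f)
  case 0
  have "subsets_of_card V 0 = {{}}"
    using assms(1) by (auto dest: finite_subset)
  then have "f {} = 0" using 0 by simp
  moreover have "up_sum f B = f {}" if "B \<in> subsets_of_card V (Suc 0)" for B
    using that by (auto simp: up_sum_def card_Suc_eq)
  ultimately show ?case by simp
next
  case (Suc j)
  define F where "F = (\<Sum>A\<in>subsets_of_card V (Suc j). (f A)\<^sup>2)"
  define X where "X = (\<Sum>C\<in>subsets_of_card V j. (down_sum V f C)\<^sup>2)"
  define Y where "Y = (\<Sum>A\<in>subsets_of_card V (Suc j). (up_sum (down_sum V f) A)\<^sup>2)"
  define c where "c = real j * (real (card V) - real j - 1)"
  \<comment> \<open>To use the induction hypothesis, \<open>down_sum V f\<close> must be centred: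
    its sum is the inner product of \<open>f\<close> with \<open>up_sum\<close> of the constant 1,
    which is the constant \<open>Suc j\<close>.\<close>
  have "(\<Sum>C\<in>subsets_of_card V j. down_sum V f C) =
      (\<Sum>B\<in>subsets_of_card V (Suc j). up_sum (\<lambda>_. 1) B * f B)"
    by (simp add: up_down_adjoint[OF assms(1)])
  also have "\<dots> = real (Suc j) * (\<Sum>A\<in>subsets_of_card V (Suc j). f A)"
    by (simp add: up_sum_def sum_distrib_left)
  finally have "Y \<le> c * X"
    using Suc unfolding X_def Y_def c_def by simp
  \<comment> \<open>The bound passes from an operator to its adjoint: \<open>X\<close> is the inner
    product of \<open>up_sum (down_sum V f)\<close> with \<open>f\<close>, so Cauchy-Schwarz and the
    bound on \<open>Y\<close> leave a factor \<open>X\<close> to cancel.\<close>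
  have "X\<^sup>2 = (\<Sum>A\<in>subsets_of_card V (Suc j). up_sum (down_sum V f) A * f A)\<^sup>2"
    by (simp add: X_def up_down_adjoint[OF assms(1)] power2_eq_square)
  also have "\<dots> \<le> Y * F"
    unfolding Y_def F_def by (rule Cauchy_Schwarz_ineq_sum)
  also have "\<dots> \<le> c * X * F"
    using \<open>Y \<le> c * X\<close> by (intro mult_right_mono) (auto simp: F_def sum_nonneg)
  finally have "X * X \<le> X * (c * F)" by (simp add: power2_eq_square algebra_simps)
  moreover have "0 \<le> X" "0 \<le> F" "0 \<le> c"
    using Suc.prems by (auto simp: X_def F_def c_def sum_nonneg)
  ultimately have "X \<le> c * F"
    by (cases "X = 0") auto
  then have "(\<Sum>B\<in>subsets_of_card V (Suc (Suc j)). (up_sum f B)\<^sup>2)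
      \<le> c * F + (real (card V) - 2 * real (Suc j)) * F"
    unfolding norm_up_sum[OF assms(1)] F_def[symmetric] X_def[symmetric] by simp
  also have "\<dots> = real (Suc j) * (real (card V) - real (Suc j) - 1) * F"
    by (simp add: c_def algebra_simps)
  finally show ?case unfolding F_def .
qed

section \<open>From the one-step bound to arbitrary levels\<close>

text \<open>A \<open>k\<close>-subset \<open>A\<close> of \<open>B\<close> survives the removal of
  \<open>x\<close> exactly when \<open>x\<close> lies in \<open>B - A\<close>, so it is counted
  \<open>card B - k\<close> times. This drives the induction on \<open>m\<close> in
  \<open>norm_subset_sum_le\<close>.\<close>

lemma up_sum_subset_sum:
  assumes "finite B"
  shows "up_sum (subset_sum k f) B = (real (card B) - real k) * subset_sum k f B"
proof -
  have "up_sum (subset_sum k f) B =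
      (\<Sum>x\<in>B. \<Sum>A | A \<in> subsets_of_card B k \<and> x \<in> B - A. f A)"
    unfolding up_sum_def subset_sum_def by (intro sum.cong refl) auto
  also have "\<dots> = (\<Sum>A\<in>subsets_of_card B k. \<Sum>x | x \<in> B \<and> x \<in> B - A. f A)"
    using assms by (intro sum.swap_restrict) auto
  also have "\<dots> = (\<Sum>A\<in>subsets_of_card B k. (real (card B) - real k) * f A)"
  proof (intro sum.cong refl)
    fix A assume A: "A \<in> subsets_of_card B k"
    have "{x. x \<in> B \<and> x \<in> B - A} = B - A" by auto
    moreover have "real (card (B - A)) = real (card B) - real k"
      using A assms by (auto simp: card_Diff_subset finite_subset card_mono of_nat_diff)
    ultimately show "(\<Sum>x | x \<in> B \<and> x \<in> B - A. f A) = (real (card B) - real k) * f A"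
      by simp
  qed
  finally show ?thesis by (simp add: subset_sum_def sum_distrib_left)
qed

lemma card_supersets_of_card:
  assumes "finite V" "A \<subseteq> V" "card A = k" "k \<le> m"
  shows "card {B. B \<subseteq> V \<and> card B = m \<and> A \<subseteq> B} = (card V - k) choose (m - k)"
proof -
  have fA: "finite A" using assms finite_subset by blast
  have "bij_betw (\<lambda>B. B - A) {B. B \<subseteq> V \<and> card B = m \<and> A \<subseteq> B} (subsets_of_card (V - A) (m - k))"
  proof (rule bij_betw_byWitness[where f' = "\<lambda>C. C \<union> A"])
    show "(\<lambda>C. C \<union> A) ` subsets_of_card (V - A) (m - k) \<subseteq> {B. B \<subseteq> V \<and> card B = m \<and> A \<subseteq> B}"
    proof clarsimp
      fix C assume C: "C \<subseteq> V - A" "card C = m - k"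
      then have "card (C \<union> A) = m - k + k"
        using assms fA finite_subset[OF C(1)] by (subst card_Un_disjoint) auto
      then show "C \<subseteq> V \<and> A \<subseteq> V \<and> card (C \<union> A) = m"
        using C assms by auto
    qed
  qed (use assms fA in \<open>auto simp: card_Diff_subset\<close>)
  then have "card {B. B \<subseteq> V \<and> card B = m \<and> A \<subseteq> B} = card (subsets_of_card (V - A) (m - k))"
    by (rule bij_betw_same_card)
  also have "\<dots> = (card V - k) choose (m - k)"
    using assms fA by (simp add: n_subsets card_Diff_subset)
  finally show ?thesis .
qed

text \<open>Each \<open>k\<close>-set lies in equally many \<open>m\<close>-sets. Hence
  \<open>subset_sum\<close> keeps centred functions centred, and \<open>S\<close> turns out uniform
  in \<open>expectation_S\<close>.\<close>

lemma sum_subset_sum: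
  assumes "finite V" "k \<le> m"
  shows "(\<Sum>B\<in>subsets_of_card V m. subset_sum k f B) =
    real ((card V - k) choose (m - k)) * (\<Sum>A\<in>subsets_of_card V k. f A)"
proof -
  have "(\<Sum>B\<in>subsets_of_card V m. subset_sum k f B) =
      (\<Sum>B\<in>subsets_of_card V m. \<Sum>A | A \<in> subsets_of_card V k \<and> A \<subseteq> B. f A)"
    unfolding subset_sum_def by (intro sum.cong refl) auto
  also have "\<dots> = (\<Sum>A\<in>subsets_of_card V k. \<Sum>B | B \<in> subsets_of_card V m \<and> A \<subseteq> B. f A)"
    using assms by (intro sum.swap_restrict) auto
  also have "\<dots> = (\<Sum>A\<in>subsets_of_card V k. real ((card V - k) choose (m - k)) * f A)"
    using assms by (intro sum.cong refl) (auto simp: card_supersets_of_card conj_assoc)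
  finally show ?thesis by (simp add: sum_distrib_left)
qed

text \<open>After division by the cardinalities this is the bound on the squared norm of the conditional
  expectation of a centred function of \<open>S\<close> given \<open>T\<close>.\<close>

lemma norm_subset_sum_le:
  assumes "finite V" "card V = n" "1 \<le> k" "k \<le> m" "m \<le> n" "k < n"
    and mean: "(\<Sum>A\<in>subsets_of_card V k. f A) = 0"
  shows "(\<Sum>B\<in>subsets_of_card V m. (subset_sum k f B)\<^sup>2) \<le>
    (real k * (real n - real m)) / (real m * (real n - real k)) *
    (real (n choose m) * (real (m choose k))\<^sup>2 / real (n choose k)) *
    (\<Sum>A\<in>subsets_of_card V k. (f A)\<^sup>2)"
  using assms(4,5)
proof (induction m rule: dec_induct)
  case base
  have "subset_sum k f A = f A" if "A \<in> subsets_of_card V k" for A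
  proof -
    have "subsets_of_card A k = {A}"
      using that assms(1) by (auto dest: card_subset_eq[OF finite_subset])
    then show ?thesis by (simp add: subset_sum_def)
  qed
  \<comment> \<open>At \<open>m = k\<close> the constant equals 1, because
    \<open>1 \<le> k < n\<close>.\<close>
  then show ?case using assms by simp
next
  case (step m)
  define F where "F = (\<Sum>A\<in>subsets_of_card V k. (f A)\<^sup>2)"
  define N where "N j = (\<Sum>B\<in>subsets_of_card V j. (subset_sum k f B)\<^sup>2)" for j
  define d where "d = real (Suc m) - real k"
  have pos: "d > 0" "real m > 0" "real n - real k > 0" "real n - real m - 1 \<ge> 0" "real (n choose k) > 0"
    using step assms by (auto simp: d_def)
  have "(\<Sum>B\<in>subsets_of_card V m. subset_sum k f B) = 0"
    using step mean assms(1) by (simp add: sum_subset_sum)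
  then have "(\<Sum>B\<in>subsets_of_card V (Suc m). (up_sum (subset_sum k f) B)\<^sup>2)
      \<le> real m * (real n - real m - 1) * N m"
    using norm_up_sum_le[OF assms(1), of m "subset_sum k f"] step assms(2) by (simp add: N_def)
  also have "(\<Sum>B\<in>subsets_of_card V (Suc m). (up_sum (subset_sum k f) B)\<^sup>2) = d\<^sup>2 * N (Suc m)"
    using assms(1) unfolding N_def d_def sum_distrib_left
    by (intro sum.cong refl) (auto simp: up_sum_subset_sum finite_subset power_mult_distrib)
  also have "real m * (real n - real m - 1) * N m \<le> real m * (real n - real m - 1) *
      ((real k * (real n - real m)) / (real m * (real n - real k)) *
       (real (n choose m) * (real (m choose k))\<^sup>2 / real (n choose k)) * F)"
    using step pos unfolding N_def F_def by (intro mult_left_mono) auto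
  also have "\<dots> = (real k * (real n - real m - 1)) / (real n - real k) *
      ((real n - real m) * real (n choose m)) * (real (m choose k))\<^sup>2 / real (n choose k) * F"
    using pos by (simp add: field_simps)
  \<comment> \<open>The factor \<open>m\<close> from the one-step bound has cancelled; the remaining
    \<open>n - m\<close> moves the first binomial to level \<open>Suc m\<close>.\<close>
  also have "(real n - real m) * real (n choose m) = real (Suc m) * real (n choose Suc m)"
  proof -
    have "(n - m) * (n choose m) = Suc m * (n choose Suc m)"
      using binomial_absorb_comp[of n m] binomial_absorption[of m n] by simp
    then show ?thesis
      using step by (metis of_nat_mult of_nat_diff Suc_leD)
  qed
  also have "real (m choose k) = d * real (Suc m choose k) / real (Suc m)"
  proof -
    have "(Suc m - k) * (Suc m choose k) = Suc m * (m choose k)"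
      using binomial_absorb_comp[of "Suc m" k] by simp
    then have "d * real (Suc m choose k) = real (Suc m) * real (m choose k)"
      unfolding d_def using step by (metis of_nat_mult of_nat_diff le_SucI)
    then show ?thesis by (simp add: field_simps)
  qed
  also have "real k * (real n - real m - 1) / (real n - real k) *
      (real (Suc m) * real (n choose Suc m)) * (d * real (Suc m choose k) / real (Suc m))\<^sup>2 /
      real (n choose k) * F =
      d\<^sup>2 * ((real k * (real n - real (Suc m))) / (real (Suc m) * (real n - real k)) *
    (real (n choose Suc m) * (real (Suc m choose k))\<^sup>2 / real (n choose k)) * F)"
  proof -
    \<comment> \<open>Read \<open>a = k\<close>, \<open>b = n - m - 1\<close>,
      \<open>q = n - k\<close>, \<open>p = Suc m\<close>, \<open>c = n choose Suc m\<close>,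
      \<open>e = Suc m choose k\<close>, \<open>h = n choose k\<close>.\<close>
    have "a * b / q * (p * c) * (d * e / p)\<^sup>2 / h * F = d\<^sup>2 * (a * b / (p * q) * (c * e\<^sup>2 / h) * F)"
      if "p \<noteq> 0" for a b c e h p q :: real
      using that by (simp add: power2_eq_square) (simp add: mult_ac)
    moreover have "real n - real m - 1 = real n - real (Suc m)" by simp
    ultimately show ?thesis by (metis of_nat_neq_0)
  qed
  finally show ?case
    unfolding N_def F_def by (rule mult_left_le_imp_le) (use pos in simp)
qed


section \<open>Joint law and expectations of \<open>S\<close> and \<open>T\<close>\<close>

locale random_subset_pair = prob_space M
  for M :: "'a measure" +
  fixes n k m :: nat and S T :: "'a \<Rightarrow> nat set"
  assumes k_le_m: "k \<le> m" and m_le_n: "m \<le> n"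
    and S_measurable [measurable]: "S \<in> measurable M (count_space (Pow {1..n}))"
    and T_measurable [measurable]: "T \<in> measurable M (count_space (Pow {1..n}))"
    and T_uniform: "\<And>A. A \<subseteq> {1..n} \<Longrightarrow>
      \<P>(\<omega> in M. T \<omega> = A) = pmf (pmf_of_set (subsets_of_card {1..n} m)) A"
    and S_uniform_given_T: "\<And>A B. A \<subseteq> {1..n} \<Longrightarrow> card A = m \<Longrightarrow> B \<subseteq> {1..n} \<Longrightarrow>
      \<P>(\<omega> in M. S \<omega> = B \<bar> T \<omega> = A) = pmf (pmf_of_set (subsets_of_card A k)) B"
begin

abbreviation ground :: "nat set" where "ground \<equiv> {1..n}"

lemma S_in_Pow: "\<omega> \<in> space M \<Longrightarrow> S \<omega> \<in> Pow ground"
  using measurable_space[OF S_measurable] by simp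

lemma T_in_Pow: "\<omega> \<in> space M \<Longrightarrow> T \<omega> \<in> Pow ground"
  using measurable_space[OF T_measurable] by simp

lemma pmf_uniform_subsets:
  assumes "finite V" "j \<le> card V"
  shows "pmf (pmf_of_set (subsets_of_card V j)) A =
    (if A \<subseteq> V \<and> card A = j then 1 / real (card V choose j) else 0)"
proof -
  have card: "card (subsets_of_card V j) = card V choose j"
    using assms by (simp add: n_subsets)
  moreover have "card V choose j \<noteq> 0" using assms by simp
  ultimately have "subsets_of_card V j \<noteq> {}" by (metis card.empty)
  then show ?thesis
    using assms card by (simp add: pmf_of_set)
qed

lemma prob_S_T:
  assumes "A \<subseteq> ground" "B \<subseteq> ground"
  shows "\<P>(\<omega> in M. S \<omega> = B \<and> T \<omega> = A) =
    (if card A = m \<and> B \<subseteq> A \<and> card B = k then 1 / (real (n choose m) * real (m choose k)) else 0)"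
proof -
  have T: "\<P>(\<omega> in M. T \<omega> = A) = (if card A = m then 1 / real (n choose m) else 0)"
    using T_uniform[OF assms(1)] m_le_n assms(1) by (simp add: pmf_uniform_subsets)
  show ?thesis
  proof (cases "card A = m")
    case True
    have "\<P>(\<omega> in M. T \<omega> = A) \<noteq> 0" using T True m_le_n by simp
    then have "\<P>(\<omega> in M. S \<omega> = B \<and> T \<omega> = A) =
        \<P>(\<omega> in M. S \<omega> = B \<bar> T \<omega> = A) * \<P>(\<omega> in M. T \<omega> = A)"
      by (simp add: cond_prob_def)
    moreover have "finite A" using assms finite_subset by blast
    ultimately show ?thesis
      using S_uniform_given_T[OF assms(1) True assms(2)] T True k_le_m
      by (simp add: pmf_uniform_subsets)
  next
    case False
    \<comment> \<open>The conditional law is given only for \<open>m\<close>-sets \<open>A\<close>;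
      for other \<open>A\<close> the event \<open>T = A\<close> is null.\<close>
    have "\<P>(\<omega> in M. S \<omega> = B \<and> T \<omega> = A) \<le> \<P>(\<omega> in M. T \<omega> = A)"
      by (intro finite_measure_mono) auto
    then show ?thesis using T False by (simp add: measure_le_0_iff)
  qed
qed

text \<open>All later expectations and integrability facts are instances. Since \<open>S\<close> and
  \<open>T\<close> take finitely many values, \<open>h (S, T)\<close> is a finite combination of
  indicators of the events weighted by \<open>prob_S_T\<close>.\<close>

lemma has_bochner_integral_S_T:
  "has_bochner_integral M (\<lambda>\<omega>. h (S \<omega>) (T \<omega>))
    ((\<Sum>A\<in>subsets_of_card ground m. subset_sum k (\<lambda>B. h B A) A) /
     (real (n choose m) * real (m choose k)))"
proof -
  define E where "E A B = {\<omega> \<in> space M. S \<omega> = B \<and> T \<omega> = A}" for A B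
  define c where "c = 1 / (real (n choose m) * real (m choose k))"
  have "has_bochner_integral M (\<lambda>\<omega>. \<Sum>A\<in>Pow ground. \<Sum>B\<in>Pow ground. indicator (E A B) \<omega> * h B A)
      (\<Sum>A\<in>Pow ground. \<Sum>B\<in>Pow ground. measure M (E A B) * h B A)"
    unfolding E_def
    by (intro has_bochner_integral_sum has_bochner_integral_mult_left has_bochner_integral_real_indicator)
       (auto simp: emeasure_eq_measure)
  moreover have "(\<Sum>A\<in>Pow ground. \<Sum>B\<in>Pow ground. indicator (E A B) \<omega> * h B A) = h (S \<omega>) (T \<omega>)"
    if "\<omega> \<in> space M" for \<omega>
  proof -
    have "(\<Sum>A\<in>Pow ground. \<Sum>B\<in>Pow ground. indicator (E A B) \<omega> * h B A) =
        (\<Sum>A\<in>Pow ground. if A = T \<omega> then (\<Sum>B\<in>Pow ground. if B = S \<omega> then h B A else 0) else 0)"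
      using that by (intro sum.cong refl) (auto simp: E_def indicator_def intro!: sum.cong)
    then show ?thesis
      using S_in_Pow[OF that] T_in_Pow[OF that] by simp
  qed
  moreover have "(\<Sum>A\<in>Pow ground. \<Sum>B\<in>Pow ground. measure M (E A B) * h B A) =
      (\<Sum>A\<in>subsets_of_card ground m. subset_sum k (\<lambda>B. h B A) A) * c"
  proof -
    have "(\<Sum>B\<in>Pow ground. measure M (E A B) * h B A) =
        (if card A = m then subset_sum k (\<lambda>B. h B A) A * c else 0)" if "A \<subseteq> ground" for A
    proof -
      have "(\<Sum>B\<in>Pow ground. measure M (E A B) * h B A) =
          (\<Sum>B\<in>Pow ground. if B \<in> subsets_of_card A k \<and> card A = m then h B A * c else 0)"
        using that by (intro sum.cong refl) (auto simp: E_def prob_S_T c_def)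
      also have "\<dots> = (\<Sum>B | B \<in> Pow ground \<and> B \<in> subsets_of_card A k \<and> card A = m. h B A * c)"
        by (intro sum.inter_filter[symmetric]) simp
      also have "{B. B \<in> Pow ground \<and> B \<in> subsets_of_card A k \<and> card A = m} =
          (if card A = m then subsets_of_card A k else {})"
        using that by auto
      finally show ?thesis by (simp add: subset_sum_def sum_distrib_right)
    qed
    then have "(\<Sum>A\<in>Pow ground. \<Sum>B\<in>Pow ground. measure M (E A B) * h B A) =
        (\<Sum>A\<in>Pow ground. if card A = m then subset_sum k (\<lambda>B. h B A) A * c else 0)"
      by (intro sum.cong refl) auto
    also have "\<dots> = (\<Sum>A | A \<in> Pow ground \<and> card A = m. subset_sum k (\<lambda>B. h B A) A * c)"
      by (intro sum.inter_filter[symmetric]) simp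
    finally show ?thesis by (simp add: sum_distrib_right)
  qed
  ultimately show ?thesis
    by (simp add: c_def cong: has_bochner_integral_cong)
qed

lemmas expectation_S_T = has_bochner_integral_integral_eq[OF has_bochner_integral_S_T]

lemma expectation_T:
  "expectation (\<lambda>\<omega>. g (T \<omega>)) = (\<Sum>A\<in>subsets_of_card ground m. g A) / real (n choose m)"
proof -
  have "subset_sum k (\<lambda>B. g A) A = real (m choose k) * g A" if "A \<in> subsets_of_card ground m" for A
    using that by (auto simp: subset_sum_def n_subsets finite_subset)
  then show ?thesis
    using k_le_m by (simp add: expectation_S_T[of "\<lambda>_. g"] sum_distrib_left[symmetric])
qed

text \<open>\<open>S\<close> is uniform on \<open>k\<close>-sets: a \<open>k\<close>-set extends to
  \<open>(n - k) choose (m - k)\<close> sets of size \<open>m\<close>, and this factor cancels by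
  the identity \<open>choose_mult\<close>.\<close>

lemma expectation_S:
  "expectation (\<lambda>\<omega>. f (S \<omega>)) = (\<Sum>B\<in>subsets_of_card ground k. f B) / real (n choose k)"
proof -
  have "real (n choose m) * real (m choose k) = real (n choose k) * real ((n - k) choose (m - k))"
    using choose_mult[OF k_le_m m_le_n] by (metis of_nat_mult)
  moreover have "real ((n - k) choose (m - k)) \<noteq> 0" using m_le_n by simp
  ultimately show ?thesis
    using k_le_m by (simp add: expectation_S_T[of "\<lambda>B _. f B"] sum_subset_sum)
qed

lemma covariance_S_T:
  "expectation (\<lambda>\<omega>. f (S \<omega>) * g (T \<omega>)) =
    (\<Sum>A\<in>subsets_of_card ground m. subset_sum k f A * g A) /
    (real (n choose m) * real (m choose k))"
  by (simp add: expectation_S_T[of "\<lambda>B A. f B * g A"] subset_sum_def sum_distrib_right)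

section \<open>Upper bound for the correlation\<close>

text \<open>After centring, the covariance is an inner product of \<open>subset_sum k f\<close> and
  \<open>g\<close> over \<open>m\<close>-sets. Cauchy-Schwarz separates them and
  \<open>norm_subset_sum_le\<close> controls the first factor.\<close>

lemma pearson_correlation_le:
  assumes "1 \<le> k" "m < n"
  shows "pearson_correlation M (\<lambda>\<omega>. \<phi> (S \<omega>)) (\<lambda>\<omega>. \<psi> (T \<omega>)) \<le>
    sqrt ((real k * (real n - real m)) / (real m * (real n - real k)))"
proof -
  define r where "r = (real k * (real n - real m)) / (real m * (real n - real k))"
  define f where "f B = \<phi> B - expectation (\<lambda>\<omega>. \<phi> (S \<omega>))" for B
  define g where "g A = \<psi> A - expectation (\<lambda>\<omega>. \<psi> (T \<omega>))" for A
  define F where "F = (\<Sum>B\<in>subsets_of_card ground k. (f B)\<^sup>2)"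
  define G where "G = (\<Sum>A\<in>subsets_of_card ground m. (g A)\<^sup>2)"
  define C where "C = expectation (\<lambda>\<omega>. f (S \<omega>) * g (T \<omega>))"
  define v where "v = (F / real (n choose k)) * (G / real (n choose m))"
  have r0: "r \<ge> 0" using assms k_le_m by (simp add: r_def)
  have v0: "v \<ge> 0" by (simp add: v_def F_def G_def sum_nonneg)
  have pos: "real (n choose k) > 0" "real (n choose m) > 0" "real (m choose k) > 0"
    using k_le_m m_le_n by auto
  have "(\<Sum>B\<in>subsets_of_card ground k. f B) = 0"
    using pos by (simp add: f_def expectation_S sum_subtractf n_subsets)
  then have W: "(\<Sum>A\<in>subsets_of_card ground m. (subset_sum k f A)\<^sup>2) \<le>
      r * (real (n choose m) * (real (m choose k))\<^sup>2 / real (n choose k)) * F"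
    unfolding r_def F_def using assms k_le_m m_le_n by (intro norm_subset_sum_le) auto
  have "C\<^sup>2 = (\<Sum>A\<in>subsets_of_card ground m. subset_sum k f A * g A)\<^sup>2 /
      (real (n choose m) * real (m choose k))\<^sup>2"
    unfolding C_def covariance_S_T by (simp add: power_divide)
  also have "\<dots> \<le> ((\<Sum>A\<in>subsets_of_card ground m. (subset_sum k f A)\<^sup>2) * G) /
      (real (n choose m) * real (m choose k))\<^sup>2"
    unfolding G_def by (intro divide_right_mono Cauchy_Schwarz_ineq_sum) simp
  also have "\<dots> \<le> (r * (real (n choose m) * (real (m choose k))\<^sup>2 / real (n choose k)) * F * G) /
      (real (n choose m) * real (m choose k))\<^sup>2"
    using W by (intro divide_right_mono mult_right_mono) (auto simp: G_def sum_nonneg)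
  also have "\<dots> = r * v"
    using pos by (simp add: v_def field_simps power2_eq_square)
  finally have "C \<le> sqrt r * sqrt v"
    by (metis real_le_rsqrt real_sqrt_mult)
  \<comment> \<open>If a variance vanishes then \<open>v = 0\<close>, and division by zero makes the
    left side 0.\<close>
  then have "C / sqrt v \<le> sqrt r"
    using v0 r0 by (cases "v = 0") (auto simp: divide_le_eq)
  moreover have "pearson_correlation M (\<lambda>\<omega>. \<phi> (S \<omega>)) (\<lambda>\<omega>. \<psi> (T \<omega>)) = C / sqrt v"
  proof -
    have "variance (\<lambda>\<omega>. \<phi> (S \<omega>)) = F / real (n choose k)"
      using expectation_S[of "\<lambda>B. (f B)\<^sup>2"] by (simp add: F_def f_def)
    moreover have "variance (\<lambda>\<omega>. \<psi> (T \<omega>)) = G / real (n choose m)"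
      using expectation_T[of "\<lambda>A. (g A)\<^sup>2"] by (simp add: G_def g_def)
    ultimately show ?thesis
      by (simp add: pearson_correlation_def C_def v_def f_def g_def)
  qed
  ultimately show ?thesis by (simp add: r_def)
qed

section \<open>Supports and degenerate cases\<close>

lemma integrable_S_T:
  fixes h :: "nat set \<Rightarrow> nat set \<Rightarrow> real"
  shows "integrable M (\<lambda>\<omega>. h (S \<omega>) (T \<omega>))"
  using has_bochner_integral_S_T[of h] by (simp add: has_bochner_integral_iff)

text \<open>The indicator of the complement has expectation zero, and a nonnegative integrable
  function with zero integral vanishes almost everywhere. The same works for
  \<open>T\<close>.\<close>

lemma AE_S: "AE \<omega> in M. S \<omega> \<in> subsets_of_card ground k"
proof -
  define f :: "nat set \<Rightarrow> real" where "f B = of_bool (B \<notin> subsets_of_card ground k)" for B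
  have "expectation (\<lambda>\<omega>. f (S \<omega>)) = 0"
    unfolding expectation_S by (simp add: f_def)
  then have "AE \<omega> in M. f (S \<omega>) = 0"
    using integral_nonneg_eq_0_iff_AE[OF integrable_S_T[of "\<lambda>B _. f B"]] by (simp add: f_def)
  then show ?thesis by eventually_elim (simp add: f_def)
qed

lemma AE_T: "AE \<omega> in M. T \<omega> \<in> subsets_of_card ground m"
proof -
  define g :: "nat set \<Rightarrow> real" where "g A = of_bool (A \<notin> subsets_of_card ground m)" for A
  have "expectation (\<lambda>\<omega>. g (T \<omega>)) = 0"
    unfolding expectation_T by (simp add: g_def)
  then have "AE \<omega> in M. g (T \<omega>) = 0"
    using integral_nonneg_eq_0_iff_AE[OF integrable_S_T[of "\<lambda>_ A. g A"]] by (simp add: g_def)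
  then show ?thesis by eventually_elim (simp add: g_def)
qed

lemma degenerate_S:
  assumes "k = 0"
  shows "degenerate M (subset_space n) S"
proof -
  have "AE \<omega> in M. S \<omega> = {}"
    using AE_S by eventually_elim (use assms in \<open>auto simp: card_eq_0_iff dest: finite_subset\<close>)
  then show ?thesis by (auto simp: degenerate_def subset_space_def)
qed

lemma degenerate_T:
  assumes "m = n"
  shows "degenerate M (subset_space n) T"
proof -
  have "AE \<omega> in M. T \<omega> = ground"
    using AE_T by eventually_elim (use assms in \<open>auto simp: card_subset_eq\<close>)
  then show ?thesis by (auto simp: degenerate_def subset_space_def)
qed

text \<open>Used in contrapositive form: one function of positive variance shows that
  \<open>S\<close> or \<open>T\<close> is not degenerate.\<close>

lemma variance_degenerate:
  assumes "degenerate M N X" and [measurable]: "(\<lambda>\<omega>. f (X \<omega>)) \<in> borel_measurable M"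
  shows "variance (\<lambda>\<omega>. f (X \<omega>)) = (0 :: real)"
proof -
  obtain c where c: "AE \<omega> in M. X \<omega> = c"
    using assms(1) by (auto simp: degenerate_def)
  have "expectation (\<lambda>\<omega>. f (X \<omega>)) = expectation (\<lambda>_. f c)"
    using c by (intro integral_cong_AE) (auto elim: eventually_mono)
  then have E: "expectation (\<lambda>\<omega>. f (X \<omega>)) = f c"
    by (simp add: prob_space)
  have "variance (\<lambda>\<omega>. f (X \<omega>)) = expectation (\<lambda>_. 0)"
    using c unfolding E by (intro integral_cong_AE) (auto elim: eventually_mono)
  then show ?thesis by simp
qed

section \<open>The extremal pair of indicators\<close>

definition contains_one :: "nat set \<Rightarrow> real" where
  "contains_one A = of_bool (1 \<in> A)"

lemma contains_one_square [simp]: "(contains_one A)\<^sup>2 = contains_one A"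
  by (simp add: contains_one_def)

lemma mean_contains_one:
  assumes "1 \<le> j" "j \<le> n"
  shows "(\<Sum>B\<in>subsets_of_card ground j. contains_one B) / real (n choose j) = real j / real n"
proof -
  have "(\<Sum>B\<in>subsets_of_card ground j. contains_one B) =
      real (card {B. B \<subseteq> ground \<and> card B = j \<and> {1} \<subseteq> B})"
    by (simp add: contains_one_def of_bool_def sum.If_cases Int_def conj_ac)
  also have "card {B. B \<subseteq> ground \<and> card B = j \<and> {1} \<subseteq> B} = (n - 1) choose (j - 1)"
    using assms by (subst card_supersets_of_card) auto
  finally have "(\<Sum>B\<in>subsets_of_card ground j. contains_one B) = real ((n - 1) choose (j - 1))" .
  moreover have "real j * real (n choose j) = real n * real ((n - 1) choose (j - 1))"
    using binomial_absorption[of "j - 1" n] assms by (metis Suc_pred' of_nat_mult One_nat_def Suc_le_eq)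
  moreover have "real n > 0" "real (n choose j) > 0" using assms by auto
  ultimately show ?thesis by (simp add: field_simps)
qed

lemma expectation_contains_one:
  assumes "1 \<le> k"
  shows "expectation (\<lambda>\<omega>. contains_one (S \<omega>)) = real k / real n"
    and "expectation (\<lambda>\<omega>. contains_one (T \<omega>)) = real m / real n"
    and "expectation (\<lambda>\<omega>. contains_one (S \<omega>) * contains_one (T \<omega>)) = real k / real n"
proof -
  show S: "expectation (\<lambda>\<omega>. contains_one (S \<omega>)) = real k / real n"
    unfolding expectation_S using assms k_le_m m_le_n by (intro mean_contains_one) auto
  show "expectation (\<lambda>\<omega>. contains_one (T \<omega>)) = real m / real n"
    unfolding expectation_T using assms k_le_m m_le_n by (intro mean_contains_one) auto
  \<comment> \<open>Only subsets \<open>B\<close> of \<open>A\<close> are summed, so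
    \<open>1 \<in> B\<close> forces \<open>1 \<in> A\<close> and the product collapses to its first
    factor.\<close>
  have "subset_sum k (\<lambda>B. contains_one B * contains_one A) A = subset_sum k contains_one A" for A
    unfolding subset_sum_def by (intro sum.cong refl) (auto simp: contains_one_def)
  then have "expectation (\<lambda>\<omega>. contains_one (S \<omega>) * contains_one (T \<omega>)) =
      expectation (\<lambda>\<omega>. contains_one (S \<omega>))"
    by (simp add: expectation_S_T[of "\<lambda>B A. contains_one B * contains_one A"]
        expectation_S_T[of "\<lambda>B _. contains_one B"])
  then show "expectation (\<lambda>\<omega>. contains_one (S \<omega>) * contains_one (T \<omega>)) = real k / real n"
    using S by simp
qed

lemma variance_contains_one:
  assumes "1 \<le> k"
  shows "variance (\<lambda>\<omega>. contains_one (S \<omega>)) = real k / real n * (1 - real k / real n)"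
    and "variance (\<lambda>\<omega>. contains_one (T \<omega>)) = real m / real n * (1 - real m / real n)"
proof -
  have *: "variance (\<lambda>\<omega>. contains_one (X \<omega>)) = p * (1 - p)"
    if "integrable M (\<lambda>\<omega>. contains_one (X \<omega>))"
      and p: "expectation (\<lambda>\<omega>. contains_one (X \<omega>)) = p" for X p
    using that(1) unfolding p[symmetric]
    by (subst variance_eq) (simp_all add: algebra_simps power2_eq_square[of "expectation _"])
  show "variance (\<lambda>\<omega>. contains_one (S \<omega>)) = real k / real n * (1 - real k / real n)"
    using integrable_S_T[of "\<lambda>B _. contains_one B"] expectation_contains_one(1)[OF assms] by (rule *)
  show "variance (\<lambda>\<omega>. contains_one (T \<omega>)) = real m / real n * (1 - real m / real n)"
    using integrable_S_T[of "\<lambda>_ A. contains_one A"] expectation_contains_one(2)[OF assms] by (rule *)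
qed

lemma pearson_correlation_contains_one:
  assumes "1 \<le> k" "m < n"
  shows "pearson_correlation M (\<lambda>\<omega>. contains_one (S \<omega>)) (\<lambda>\<omega>. contains_one (T \<omega>)) =
    sqrt ((real k * (real n - real m)) / (real m * (real n - real k)))"
proof -
  \<comment> \<open>In these terms the covariance is \<open>p - p * q\<close>, the variances are
    those of Bernoulli variables, and the squared target is
    \<open>p * (1 - q) / (q * (1 - p))\<close>.\<close>
  define p q where "p = real k / real n" and "q = real m / real n"
  have pq: "0 < p" "p < 1" "0 < q" "q < 1"
    using assms k_le_m by (auto simp: p_def q_def)
  note int = integrable_S_T[of "\<lambda>B _. contains_one B"] integrable_S_T[of "\<lambda>_ A. contains_one A"]
    integrable_S_T[of "\<lambda>B A. contains_one B * contains_one A"]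
  note E = expectation_contains_one[OF assms(1), folded p_def q_def]
  have "expectation (\<lambda>\<omega>. (contains_one (S \<omega>) - p) * (contains_one (T \<omega>) - q)) =
      expectation (\<lambda>\<omega>. contains_one (S \<omega>) * contains_one (T \<omega>)
        - q * contains_one (S \<omega>) - p * contains_one (T \<omega>) + p * q)"
    by (intro Bochner_Integration.integral_cong refl) (simp add: algebra_simps)
  also have "\<dots> = p * (1 - q)"
    using int E by (simp add: prob_space algebra_simps)
  finally have cov: "expectation (\<lambda>\<omega>. (contains_one (S \<omega>) - p) * (contains_one (T \<omega>) - q)) =
      p * (1 - q)" .
  have "pearson_correlation M (\<lambda>\<omega>. contains_one (S \<omega>)) (\<lambda>\<omega>. contains_one (T \<omega>)) =
      p * (1 - q) / sqrt (p * (1 - p) * (q * (1 - q)))"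
    using variance_contains_one[OF assms(1), folded p_def q_def] cov
    by (simp add: pearson_correlation_def E)
  also have "\<dots> = sqrt (p * (1 - q) / (q * (1 - p)))"
  proof (rule real_sqrt_unique[symmetric])
    have "(p * (1 - q))\<^sup>2 / (p * (1 - p) * (q * (1 - q))) = p * (1 - q) / (q * (1 - p))"
      using pq by (simp add: power2_eq_square)
    then show "(p * (1 - q) / sqrt (p * (1 - p) * (q * (1 - q))))\<^sup>2 = p * (1 - q) / (q * (1 - p))"
      using pq by (simp add: power_divide)
  qed (use pq in simp)
  also have "p * (1 - q) / (q * (1 - p)) = (real k * (real n - real m)) / (real m * (real n - real k))"
    using assms k_le_m by (simp add: p_def q_def field_simps)
  finally show ?thesis .
qed

section \<open>Evaluation of the supremum\<close>

lemma maximal_correlation_S_T: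
  "maximal_correlation M (subset_space n) (subset_space n) S T =
    sqrt ((real k * (real n - real m)) / (real m * (real n - real k)))"
proof (cases "k = 0 \<or> m = n")
  \<comment> \<open>Here the numerator is 0. The 0/0 cases fall here too, since \<open>m = 0\<close>
    forces \<open>k = 0\<close> and \<open>k = n\<close> forces \<open>m = n\<close>; division by
    zero yields 0, as the convention demands.\<close>
  case True
  then have "degenerate M (subset_space n) S \<or> degenerate M (subset_space n) T"
    using degenerate_S degenerate_T by auto
  then show ?thesis
    using True by (auto simp: maximal_correlation_def)
next
  case False
  then have km: "1 \<le> k" "m < n" using m_le_n by auto
  have fin_meas: "f \<in> borel_measurable (subset_space n)" for f :: "nat set \<Rightarrow> real"
    by (simp add: subset_space_def)
  have one: "square_integrable_nonconst M (\<lambda>\<omega>. contains_one (S \<omega>))"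
    "square_integrable_nonconst M (\<lambda>\<omega>. contains_one (T \<omega>))"
    using integrable_S_T[of "\<lambda>B _. contains_one B"] integrable_S_T[of "\<lambda>_ A. contains_one A"]
      variance_contains_one[OF km(1)] km k_le_m
    by (auto simp: square_integrable_nonconst_def)
  then have "\<not> degenerate M (subset_space n) S" "\<not> degenerate M (subset_space n) T"
    using variance_degenerate[of _ S contains_one] variance_degenerate[of _ T contains_one]
    by (auto simp: square_integrable_nonconst_def)
  moreover have "Sup {pearson_correlation M (\<lambda>\<omega>. \<phi> (S \<omega>)) (\<lambda>\<omega>. \<psi> (T \<omega>)) | \<phi> \<psi>.
             \<phi> \<in> borel_measurable (subset_space n) \<and> \<psi> \<in> borel_measurable (subset_space n) \<and>
             square_integrable_nonconst M (\<lambda>\<omega>. \<phi> (S \<omega>)) \<and>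
             square_integrable_nonconst M (\<lambda>\<omega>. \<psi> (T \<omega>))} =
      sqrt ((real k * (real n - real m)) / (real m * (real n - real k)))"
  \<comment> \<open>The supremum is a maximum: the indicators are an admissible pair attaining the
    value, and every admissible pair obeys the upper bound.\<close>
  proof (rule cSup_eq_maximum, goal_cases)
    case 1
    show ?case
      using pearson_correlation_contains_one[OF km, symmetric] one fin_meas by blast
  next
    case (2 x)
    then show ?case using pearson_correlation_le[OF km] by blast
  qed
  ultimately show ?thesis by (simp add: maximal_correlation_def)
qed

end

theorem theorem1p6:
  fixes n k m :: nat and M :: "'a measure" and S T :: "'a \<Rightarrow> nat set"
  assumes "n \<ge> 1" and "k \<le> m" and "m \<le> n"
    and "prob_space M"
    and "S \<in> measurable M (subset_space n)"
    and "T \<in> measurable M (subset_space n)"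
    and T_uniform: "\<And>A. A \<subseteq> {1..n} \<Longrightarrow>
      \<P>(\<omega> in M. T \<omega> = A) = pmf (pmf_of_set {A. A \<subseteq> {1..n} \<and> card A = m}) A"
    and S_uniform_given_T: "\<And>A B. A \<subseteq> {1..n} \<Longrightarrow> card A = m \<Longrightarrow> B \<subseteq> {1..n} \<Longrightarrow>
      \<P>(\<omega> in M. S \<omega> = B \<bar> T \<omega> = A) = pmf (pmf_of_set {B. B \<subseteq> A \<and> card B = k}) B"
  shows "maximal_correlation M (subset_space n) (subset_space n) S T =
    sqrt ((real k * (real n - real m)) / (real m * (real n - real k)))"
proof -
  interpret prob_space M by fact
  interpret random_subset_pair M n k m S T
    using assms unfolding subset_space_def by unfold_locales
  show ?thesis by (rule maximal_correlation_S_T)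
qed

end
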